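(* Let $\mathcal{X}=\prod_{i=1}^n \mathcal{X}_i$ where each $\mathcal{X}_i\subset\mathbb{R}$ is a (nonempty) finite set, and let $F:\mathcal{X}\to\mathbb{R}$ be any normalized function. Then there exist normalized submodular functions $G,H:\mathcal{X}\to\mathbb{R}$ such that $F=G-H$. Moreover, $G$ and $H$ can be chosen to be normalized and strictly submodular.
   Context: For $\mathcal{X}=\prod_{i=1}^n\mathcal{X}_i$ with $\mathcal{X}_i\subset\mathbb{R}$ compact, $x\le y$ means $x_i\le y_i$ for all $i$, and $\min\{x,y\}$, $\max\{x,y\}$ are taken componentwise. Let $x^{\min}$ be the smallest element of $\mathcal{X}$ (componentwise minimum). A function $F:\mathcal{X}\to\mathbb{R}$ is normalized if $F(x^{\min})=0$. It is submodular if $F(x)+F(y)\ge F(\min\{x,y\})+F(\max\{x,y\})$ for all $x,y\in\mathcal{X}$, and strictly submodular if this inequality is strict whenever $x$ and $y$ are not comparable (neither $x\le y$ nor $y\le x$). *)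

theory Defs
  imports "HOL-Analysis.Analysis"
begin

text \<open>
  A family of subsets of the reals indexed by a finite type \<open>'n\<close> stands for \<open>X\<^sub>1, \<dots>, X\<^sub>n\<close>.  The library
  order on \<open>real ^ 'n\<close> is componentwise, and \<open>inf\<close>, \<open>sup\<close> are the componentwise minimum and maximum.
  A function on a subset \<open>S\<close> is represented by a total function of which only the values on \<open>S\<close> matter.
\<close>

definition product_domain :: "('n \<Rightarrow> real set) \<Rightarrow> (real ^ 'n) set" where
  "product_domain X = {x. \<forall>i. x $ i \<in> X i}"

text \<open>For nonempty compact (in particular finite) factors the infimum below is attained, so this is the
  smallest element of the product.\<close>

definition x_min :: "('n \<Rightarrow> real set) \<Rightarrow> real ^ 'n" where
  "x_min X = (\<chi> i. Inf (X i))"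

definition normalized :: "('n \<Rightarrow> real set) \<Rightarrow> (real ^ 'n \<Rightarrow> real) \<Rightarrow> bool" where
  "normalized X F \<longleftrightarrow> F (x_min X) = 0"

definition submodular_on :: "(real ^ 'n) set \<Rightarrow> (real ^ 'n \<Rightarrow> real) \<Rightarrow> bool" where
  "submodular_on S F \<longleftrightarrow> (\<forall>x\<in>S. \<forall>y\<in>S. F x + F y \<ge> F (inf x y) + F (sup x y))"

definition strictly_submodular_on :: "(real ^ 'n) set \<Rightarrow> (real ^ 'n \<Rightarrow> real) \<Rightarrow> bool" where
  "strictly_submodular_on S F \<longleftrightarrow> submodular_on S F \<and>
     (\<forall>x\<in>S. \<forall>y\<in>S. \<not> x \<le> y \<and> \<not> y \<le> x \<longrightarrow> F x + F y > F (inf x y) + F (sup x y))"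

end

theory Submission
  imports Defs
begin

text \<open>
  The second difference \<open>F x + F y - F (inf x y) - F (sup x y)\<close> is linear in \<open>F\<close>, ignores additive
  constants, and vanishes at comparable pairs.  So strict submodularity only asks for it to be positive
  at incomparable pairs, of which a finite domain has finitely many.  If \<open>J\<close> is any strictly submodular
  function, then its second difference is bounded away from \<open>0\<close> on these pairs, while that of \<open>F\<close> is
  bounded; hence \<open>F + c * J\<close> is strictly submodular for every large enough \<open>c\<close>
  (\<open>exists_dominating_multiple\<close>), and \<open>F = (F + c * J) - c * J\<close> is the required decomposition, once
  \<open>J\<close> has been shifted to vanish at the smallest point.

  Strictly concave functions of the coordinate sum are strictly submodular on all of \<open>real ^ 'n\<close>.
  For \<open>J x = - (\<Sum>i. x $ i)\<^sup>2\<close> the second difference is an explicit product, whose two factors are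
  positive at incomparable pairs (\<open>second_difference_neg_square_sum\<close>, \<open>sum_diff_inf_pos\<close>).
\<close>

definition second_difference :: "(real ^ 'n \<Rightarrow> real) \<Rightarrow> real ^ 'n \<Rightarrow> real ^ 'n \<Rightarrow> real" where
  "second_difference F x y = F x + F y - F (inf x y) - F (sup x y)"

lemma second_difference_comparable:
  assumes "x \<le> y \<or> y \<le> x"
  shows "second_difference F x y = 0"
  using assms by (auto simp: second_difference_def inf_absorb1 inf_absorb2 sup_absorb1 sup_absorb2)

lemma strictly_submodular_onI:
  assumes "\<And>x y. x \<in> S \<Longrightarrow> y \<in> S \<Longrightarrow> \<not> x \<le> y \<Longrightarrow> \<not> y \<le> x \<Longrightarrow> second_difference F x y > 0"
  shows "strictly_submodular_on S F"
proof -
  have "second_difference F x y \<ge> 0" if "x \<in> S" "y \<in> S" for x y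
    using assms[OF that] second_difference_comparable[of x y F] by fastforce
  then show ?thesis
    using assms unfolding strictly_submodular_on_def submodular_on_def second_difference_def by force
qed

lemma finite_product_domain:
  fixes X :: "'n::finite \<Rightarrow> real set"
  assumes "\<And>i. finite (X i)"
  shows "finite (product_domain X)"
proof (rule finite_subset)
  show "product_domain X \<subseteq> vec_lambda ` (PiE UNIV X)"
  proof
    fix x assume "x \<in> product_domain X"
    then have "vec_nth x \<in> PiE UNIV X"
      by (auto simp: product_domain_def)
    then show "x \<in> vec_lambda ` (PiE UNIV X)"
      by (metis image_eqI vec_nth_inverse)
  qed
  show "finite (vec_lambda ` (PiE UNIV X))"
    using assms by (intro finite_imageI finite_PiE) auto
qed

text \<open>
  If \<open>m\<close> is the coordinate sum of \<open>inf x y\<close>, and \<open>a\<close>, \<open>b\<close> are those of the excesses \<open>x - inf x y\<close> and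
  \<open>y - inf x y\<close>, then \<open>x\<close>, \<open>y\<close>, \<open>sup x y\<close> have coordinate sums \<open>m + a\<close>, \<open>m + b\<close>, \<open>m + a + b\<close>, and
  the claim becomes \<open>(m + a + b)\<^sup>2 + m\<^sup>2 - (m + a)\<^sup>2 - (m + b)\<^sup>2 = 2 * a * b\<close>.
\<close>

lemma second_difference_neg_square_sum:
  fixes x y :: "real ^ 'n::finite"
  shows "second_difference (\<lambda>z. - (\<Sum>i\<in>UNIV. z $ i)\<^sup>2) x y
       = 2 * (\<Sum>i\<in>UNIV. x $ i - inf x y $ i) * (\<Sum>i\<in>UNIV. y $ i - inf x y $ i)"
proof -
  have "inf x y $ i + sup x y $ i = x $ i + y $ i" for i
    by (simp add: inf_vec_def sup_vec_def inf_real_def sup_real_def min_def max_def)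
  then have "(\<Sum>i\<in>UNIV. inf x y $ i) + (\<Sum>i\<in>UNIV. sup x y $ i)
           = (\<Sum>i\<in>UNIV. x $ i) + (\<Sum>i\<in>UNIV. y $ i)"
    by (simp add: sum.distrib[symmetric])
  then have sup_sum: "(\<Sum>i\<in>UNIV. sup x y $ i)
           = (\<Sum>i\<in>UNIV. x $ i) + (\<Sum>i\<in>UNIV. y $ i) - (\<Sum>i\<in>UNIV. inf x y $ i)"
    by simp
  show ?thesis
    unfolding second_difference_def sum_subtractf sup_sum by (simp add: power2_eq_square algebra_simps)
qed

lemma sum_diff_inf_pos:
  fixes x y :: "real ^ 'n::finite"
  assumes "\<not> x \<le> y"
  shows "(\<Sum>i\<in>UNIV. x $ i - inf x y $ i) > 0"
proof -
  obtain k where "\<not> x $ k \<le> y $ k"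
    using assms by (auto simp: less_eq_vec_def)
  then show ?thesis
    by (intro sum_pos2[of _ k]) (auto simp: inf_vec_def inf_real_def)
qed

lemma exists_dominating_multiple:
  fixes f g :: "'a \<Rightarrow> real"
  assumes "finite P" and "\<And>p. p \<in> P \<Longrightarrow> g p > 0"
  shows "\<exists>c>0. \<forall>p\<in>P. f p + c * g p > 0"
proof (intro exI conjI ballI)
  \<comment> \<open>Any \<open>c\<close> above every ratio \<open>\<bar>f p\<bar> / g p\<close> will do; their sum, unlike their maximum, also makes
    sense when \<open>P\<close> is empty.\<close>
  let ?c = "1 + (\<Sum>p\<in>P. \<bar>f p\<bar> / g p)"
  have nonneg: "\<bar>f p\<bar> / g p \<ge> 0" if "p \<in> P" for p
    using assms(2)[OF that] by simp
  then show "?c > 0"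
    by (simp add: add_pos_nonneg sum_nonneg)
  fix p assume p: "p \<in> P"
  have "\<bar>f p\<bar> / g p < ?c"
    using member_le_sum[of p P "\<lambda>p. \<bar>f p\<bar> / g p"] p nonneg assms(1) by force
  then have "\<bar>f p\<bar> < ?c * g p"
    using assms(2)[OF p] by (simp only: pos_divide_less_eq)
  then show "f p + ?c * g p > 0"
    by linarith
qed

theorem proposition3p1:
  fixes X :: "'n::finite \<Rightarrow> real set" and F :: "real ^ 'n \<Rightarrow> real"
  assumes "\<And>i. finite (X i)" and "\<And>i. X i \<noteq> {}"
    and "normalized X F"
  shows "(\<exists>G H. normalized X G \<and> submodular_on (product_domain X) G
            \<and> normalized X H \<and> submodular_on (product_domain X) H
            \<and> (\<forall>x\<in>product_domain X. F x = G x - H x))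
       \<and> (\<exists>G H. normalized X G \<and> strictly_submodular_on (product_domain X) G
            \<and> normalized X H \<and> strictly_submodular_on (product_domain X) H
            \<and> (\<forall>x\<in>product_domain X. F x = G x - H x))"
proof -
  define S where "S = product_domain X"
  define J :: "real ^ 'n \<Rightarrow> real" where "J = (\<lambda>z. - (\<Sum>i\<in>UNIV. z $ i)\<^sup>2)"
  define P where "P = {(x, y) \<in> S \<times> S. \<not> x \<le> y \<and> \<not> y \<le> x}"
  have J_pos: "second_difference J x y > 0" if "\<not> x \<le> y" "\<not> y \<le> x" for x y
    using sum_diff_inf_pos[OF that(1)] sum_diff_inf_pos[OF that(2)]
    by (simp add: J_def second_difference_neg_square_sum inf_commute)
  have "finite S"
    using finite_product_domain[OF assms(1)] by (simp add: S_def)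
  then have "finite P"
    by (rule_tac finite_subset[of P "S \<times> S"]) (auto simp: P_def)
  then obtain c where "c > 0"
    and c: "\<forall>p\<in>P. (case p of (x, y) \<Rightarrow> second_difference F x y)
                 + c * (case p of (x, y) \<Rightarrow> second_difference J x y) > 0"
    using exists_dominating_multiple[of P "\<lambda>(x, y). second_difference J x y"
        "\<lambda>(x, y). second_difference F x y"] J_pos
    by (auto simp: P_def)
  define H where "H = (\<lambda>x. c * (J x - J (x_min X)))"
  define G where "G = (\<lambda>x. F x + H x)"
  have diff_H: "second_difference H x y = c * second_difference J x y" for x y
    by (simp add: second_difference_def H_def algebra_simps)
  have diff_G: "second_difference G x y = second_difference F x y + c * second_difference J x y" for x y
    by (simp add: diff_H[symmetric]) (simp add: second_difference_def G_def)
  have "strictly_submodular_on S H"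
    using J_pos \<open>c > 0\<close> by (intro strictly_submodular_onI) (simp add: diff_H)
  moreover have "strictly_submodular_on S G"
    using c by (intro strictly_submodular_onI) (auto simp: diff_G P_def)
  moreover have "normalized X H" "normalized X G"
    using assms(3) by (simp_all add: normalized_def G_def H_def)
  moreover have "\<forall>x\<in>S. F x = G x - H x"
    by (simp add: G_def)
  ultimately show ?thesis
    unfolding S_def strictly_submodular_on_def by blast
qed

end
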